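(* Let $t$ be a positive odd integer exceeding one, and let $M$ be a matroid. Suppose that $\sigma$ is an odd $t$-cyclic ordering of $M$. If $\Phi=(P_1, P_2, \ldots, P_m)$ is a concatenation of $\sigma$ with $|P_i|\ge t-1$ for all $i\in [m]$, then $\Phi$ is a $t$-daisy. Moreover, for all $i\in [m]$, we have $\sqcap(P_i, P_{i+1})=\frac{1}{2}(t-1)$ and, for all non-consecutive petals $P_i$ and $P_j$, we have $\sqcap(P_i, P_j)\le \frac{1}{2}(t-3)$.
   Context: Notation: $[n]=\{1,\ldots,n\}$. For a cyclic ordering $(e_1,\ldots,e_n)$ of $E(M)$, subscripts of elements are interpreted modulo $n$; subscripts of petals $P_1,\ldots,P_m$ are interpreted modulo $m$. Petals $P_i$ and $P_j$ are non-consecutive if $i\neq j$ and $i,j$ are not consecutive in the cyclic order $(1,2,\ldots,m)$. $t$-cyclic orderings: Let $M$ be a matroid with $n=|E(M)|$ and let $t$ be a positive integer with $n\ge t+1$. A cyclic ordering $\sigma=(e_1,\ldots,e_n)$ of $E(M)$ is an odd $t$-cyclic ordering of $M$ if, for all odd $i\in[n]$, the set $\{e_i,e_{i+1},\ldots,e_{i+t-1}\}$ is a $t$-element circuit and $\{e_{i+1},e_{i+2},\ldots,e_{i+t}\}$ is a $t$-element cocircuit. Concatenation: $(P_1,\ldots,P_m)$ is a concatenation of $\sigma$ if there are indices $1\le k_1<k_2<\cdots<k_m\le n$ such that, for each $i\in[m]$, $P_i$ consists of the elements $e_{k_{i-1}},e_{k_{i-1}+1},\ldots,e_{k_i-1}$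 read cyclically in $\sigma$, where $k_0=k_m$; that is, the $P_i$ are non-empty sets of consecutive elements that partition $E(M)$ and occur in this cyclic order (for $m=1$, $P_1=E(M)$). Connectivity: for $X\subseteq E(M)$, $\lambda(X)=r(X)+r(E(M)-X)-r(M)$. The set $X$ is exactly $k$-separating if $\lambda(X)=k-1$. For $X,Y\subseteq E(M)$, $\sqcap(X,Y)=r(X)+r(Y)-r(X\cup Y)$. Flowers: For an integer $m>1$, a partition $\Phi=(P_1,\ldots,P_m)$ of $E(M)$ into non-empty sets (petals) is a $k$-flower if each $P_i$ is exactly $k$-separating and, when $m\ge 3$, each $P_i\cup P_{i+1}$ is exactly $k$-separating. By convention $(E(M))$ is a $k$-flower with a single petal. A $k$-flower $\Phi$ is a $k$-daisy if $\bigcup_{i\in I}P_i$ is exactly $k$-separating for precisely those non-empty proper subsets $I$ of $[m]$ whose members form a consecutive set in the cyclic order $(1,2,\ldots,m)$.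
   Formalization: The equality ⊓(P_i,P_{i+1}) = (t-1)/2 is stated only for m ≥ 3 petals; it always fails for m = 2, where ⊓(P_1,P_2) = t-1 (e.g. U_{2,4}, t = 3), and for m = 1, where it equals r(M). All other claims are for every m. *)

theory Defs
  imports Complex_Main
begin

section \<open>Matroids\<close>

locale matroid =
  fixes E :: "'a set" and indep :: "'a set \<Rightarrow> bool"
  assumes finite_ground: "finite E"
    and indep_subset_ground: "indep X \<Longrightarrow> X \<subseteq> E"
    and indep_empty: "indep {}"
    and indep_subset: "indep X \<Longrightarrow> Y \<subseteq> X \<Longrightarrow> indep Y"
    and indep_augment:
      "indep X \<Longrightarrow> indep Y \<Longrightarrow> card X < card Y \<Longrightarrow> \<exists>y\<in>Y - X. indep (insert y X)"

definition basis :: "('a set \<Rightarrow> bool) \<Rightarrow> 'a set \<Rightarrow> bool" where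
  "basis indep B \<longleftrightarrow> indep B \<and> (\<forall>X. indep X \<and> B \<subseteq> X \<longrightarrow> X = B)"

definition circuit :: "'a set \<Rightarrow> ('a set \<Rightarrow> bool) \<Rightarrow> 'a set \<Rightarrow> bool" where
  "circuit E indep C \<longleftrightarrow> C \<subseteq> E \<and> \<not> indep C \<and> (\<forall>D. D \<subset> C \<longrightarrow> indep D)"

text \<open>The bases of the dual matroid are the complements of the bases.\<close>

definition dual_indep :: "'a set \<Rightarrow> ('a set \<Rightarrow> bool) \<Rightarrow> 'a set \<Rightarrow> bool" where
  "dual_indep E indep X \<longleftrightarrow> (\<exists>B. basis indep B \<and> X \<subseteq> E - B)"

definition cocircuit :: "'a set \<Rightarrow> ('a set \<Rightarrow> bool) \<Rightarrow> 'a set \<Rightarrow> bool" where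
  "cocircuit E indep C \<longleftrightarrow> circuit E (dual_indep E indep) C"

definition rank_of :: "('a set \<Rightarrow> bool) \<Rightarrow> 'a set \<Rightarrow> nat" where
  "rank_of indep X = Max {card I | I. I \<subseteq> X \<and> indep I}"


section \<open>Connectivity\<close>

text \<open>These are integer-valued so that subtraction is not truncated.\<close>

definition connectivity :: "'a set \<Rightarrow> ('a set \<Rightarrow> bool) \<Rightarrow> 'a set \<Rightarrow> int" where
  "connectivity E indep X =
     int (rank_of indep X) + int (rank_of indep (E - X)) - int (rank_of indep E)"

definition exactly_separating ::
    "'a set \<Rightarrow> ('a set \<Rightarrow> bool) \<Rightarrow> nat \<Rightarrow> 'a set \<Rightarrow> bool" where
  "exactly_separating E indep k X \<longleftrightarrow> X \<subseteq> E \<and> connectivity E indep X = int k - 1"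

definition local_connectivity :: "('a set \<Rightarrow> bool) \<Rightarrow> 'a set \<Rightarrow> 'a set \<Rightarrow> int" where
  "local_connectivity indep X Y =
     int (rank_of indep X) + int (rank_of indep Y) - int (rank_of indep (X \<union> Y))"


section \<open>Cyclic orderings and concatenations\<close>

text \<open>A sequence \<open>(x\<^sub>1, \<dots>, x\<^sub>n)\<close>, whether of elements or of petals, is a list; \<open>cyc xs i\<close> is its
  entry with the one-based subscript \<open>i\<close> read modulo \<open>n\<close>.  Thus \<open>cyc xs 0 = cyc xs n = x\<^sub>n\<close> and
  \<open>cyc xs (n + 1) = x\<^sub>1\<close>; the summand \<open>length xs\<close> only avoids truncated subtraction at \<open>i = 0\<close>.\<close>

definition cyc :: "'b list \<Rightarrow> nat \<Rightarrow> 'b" where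
  "cyc xs i = xs ! ((i + length xs - 1) mod length xs)"

definition odd_cyclic_ordering ::
    "'a set \<Rightarrow> ('a set \<Rightarrow> bool) \<Rightarrow> nat \<Rightarrow> 'a list \<Rightarrow> bool" where
  "odd_cyclic_ordering E indep t es \<longleftrightarrow>
     1 \<le> t \<and> t + 1 \<le> card E \<and> distinct es \<and> set es = E \<and>
     (\<forall>i\<in>{1..length es}. odd i \<longrightarrow>
        card (cyc es ` {i..i + t - 1}) = t \<and> circuit E indep (cyc es ` {i..i + t - 1}) \<and>
        card (cyc es ` {i + 1..i + t}) = t \<and> cocircuit E indep (cyc es ` {i + 1..i + t}))"

text \<open>The first petal runs from \<open>k\<^sub>0 = k\<^sub>m\<close> around the end of the list to \<open>k\<^sub>1 - 1\<close>, hence the upper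
  bound \<open>k\<^sub>1 + n\<close>.\<close>

definition concatenation :: "'a list \<Rightarrow> 'a set list \<Rightarrow> bool" where
  "concatenation es Ps \<longleftrightarrow>
     (let n = length es; m = length Ps in
        1 \<le> m \<and>
        (\<exists>k :: nat \<Rightarrow> nat.
           1 \<le> k 1 \<and> k m \<le> n \<and> (\<forall>i\<in>{1..<m}. k i < k (i + 1)) \<and> k 0 = k m \<and>
           (\<forall>i\<in>{1..m}.
              cyc Ps i = cyc es ` {k (i - 1)..<(if i = 1 then k 1 + n else k i)})))"


section \<open>Flowers and daisies\<close>

definition flower :: "'a set \<Rightarrow> ('a set \<Rightarrow> bool) \<Rightarrow> nat \<Rightarrow> 'a set list \<Rightarrow> bool" where
  "flower E indep k Ps \<longleftrightarrow>
     Ps = [E] \<or>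
     (1 < length Ps \<and>
      (\<forall>i\<in>{1..length Ps}. cyc Ps i \<noteq> {}) \<and>
      (\<forall>i\<in>{1..length Ps}. \<forall>j\<in>{1..length Ps}. i \<noteq> j \<longrightarrow> cyc Ps i \<inter> cyc Ps j = {}) \<and>
      (\<Union>i\<in>{1..length Ps}. cyc Ps i) = E \<and>
      (\<forall>i\<in>{1..length Ps}. exactly_separating E indep k (cyc Ps i)) \<and>
      (3 \<le> length Ps \<longrightarrow>
         (\<forall>i\<in>{1..length Ps}. exactly_separating E indep k (cyc Ps i \<union> cyc Ps (i + 1)))))"

definition consecutive_set :: "nat \<Rightarrow> nat set \<Rightarrow> bool" where
  "consecutive_set m I \<longleftrightarrow>
     (\<exists>a l. I = {j \<in> {1..m}. \<exists>d<l. j mod m = (a + d) mod m})"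

definition daisy :: "'a set \<Rightarrow> ('a set \<Rightarrow> bool) \<Rightarrow> nat \<Rightarrow> 'a set list \<Rightarrow> bool" where
  "daisy E indep k Ps \<longleftrightarrow>
     flower E indep k Ps \<and>
     (\<forall>I. I \<noteq> {} \<and> I \<subset> {1..length Ps} \<longrightarrow>
        (exactly_separating E indep k (\<Union>i\<in>I. cyc Ps i) \<longleftrightarrow> consecutive_set (length Ps) I))"

definition non_consecutive :: "nat \<Rightarrow> nat \<Rightarrow> nat \<Rightarrow> bool" where
  "non_consecutive m i j \<longleftrightarrow>
     i \<noteq> j \<and> (i + 1) mod m \<noteq> j mod m \<and> (j + 1) mod m \<noteq> i mod m"

end

theory Submission
  imports Defs
begin

text \<open>
  Write \<open>t = 2 * h + 1\<close> and number the elements by positions modulo \<open>n\<close>.  Circuits of length \<open>t\<close>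
  occupy the windows beginning (and hence ending) at an odd position, cocircuits those beginning and
  ending at an even position.  For this to make sense around the cycle, \<open>n\<close> must be even: comparing
  a circuit and a cocircuit with the rank gives \<open>4 * h \<le> n\<close>, and if \<open>n\<close> were odd there would be
  room for a circuit that meets a cocircuit in a single element (\<open>cyclic_matroid_of_ordering\<close>).

  The whole proof consists in comparing ranks with the number of even positions.  Let an interval
  grow to the right.  A window of \<open>2 * h\<close> positions is independent, and contains \<open>h\<close> even ones.
  After that, an odd position completes a circuit, so it does not raise the rank; an even position
  begins a cocircuit that lies ahead of the interval, so it raises the rank by one as long as this
  cocircuit does not reach round to the start.  Hence an interval such that it and its complement
  have at least \<open>2 * h\<close> positions has rank \<open>h\<close> more than its number of even positions, and the rank
  of the matroid is \<open>n div 2\<close>.  Applied to an interval and its complement, this gives connectivity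
  \<open>2 * h = t - 1\<close>; applied to two adjacent intervals and their union, it gives local connectivity
  \<open>h\<close>.

  A union of petals with gaps can only have larger rank, because the cocircuit that begins at an even
  position still misses everything to the left, whether or not it is all of an interval
  (\<open>rank_petals_ge\<close>).  The decisive gain is \<open>rank_petals_gap_ge\<close>: a gap of at least \<open>2 * h\<close>
  positions leaves room for the cocircuits that begin or end near the first positions behind it, so
  that the first odd position behind the gap raises the rank as well.  Thus each set of petals that is
  not consecutive has rank at least \<open>h + 1\<close> more than its number of even positions.  Its complement
  has at least \<open>h\<close> more, so its connectivity exceeds \<open>t - 1\<close>, and for two petals that are not
  consecutive the local connectivity drops to at most \<open>h - 1\<close>.
\<close>

section \<open>Rank, circuits and cocircuits\<close>

context matroid
begin

lemma finite_indep: "indep X \<Longrightarrow> finite X"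
  using indep_subset_ground finite_ground finite_subset by blast

lemma finite_rank_candidates: "finite {card I | I. I \<subseteq> X \<and> indep I}"
proof (rule finite_subset)
  show "{card I | I. I \<subseteq> X \<and> indep I} \<subseteq> card ` Pow E"
    using indep_subset_ground by blast
qed (simp add: finite_ground)

lemma card_le_rank: "I \<subseteq> X \<Longrightarrow> indep I \<Longrightarrow> card I \<le> rank_of indep X"
  unfolding rank_of_def by (rule Max_ge[OF finite_rank_candidates]) blast

lemma rank_witness:
  obtains I where "I \<subseteq> X" "indep I" "card I = rank_of indep X"
proof -
  have "rank_of indep X \<in> {card I | I. I \<subseteq> X \<and> indep I}"
    unfolding rank_of_def
    by (rule Max_in[OF finite_rank_candidates]) (use indep_empty in blast)
  then show ?thesis using that by fastforce
qed

lemma rank_mono: "X \<subseteq> Y \<Longrightarrow> rank_of indep X \<le> rank_of indep Y"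
  by (metis rank_witness card_le_rank subset_trans)

lemma rank_le_card: "finite X \<Longrightarrow> rank_of indep X \<le> card X"
  by (metis rank_witness card_mono)

lemma rank_indep: "indep X \<Longrightarrow> rank_of indep X = card X"
  by (meson card_le_rank finite_indep le_antisym order_refl rank_le_card)

lemma rank_insert_le: "rank_of indep (insert x X) \<le> rank_of indep X + 1"
proof -
  obtain I where I: "I \<subseteq> insert x X" "indep I" "card I = rank_of indep (insert x X)"
    by (rule rank_witness)
  have "card (I - {x}) \<le> rank_of indep X"
    using I indep_subset[of I "I - {x}"] by (intro card_le_rank) auto
  then show ?thesis
    using I(3) card_Diff1_le[of I x] by (simp add: card_Diff_singleton_if split: if_splits)
qed

lemma extend_to_rank:
  assumes "indep I" "I \<subseteq> X"
  obtains J where "I \<subseteq> J" "J \<subseteq> X" "indep J" "card J = rank_of indep X"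
proof -
  let ?P = "\<lambda>J. I \<subseteq> J \<and> J \<subseteq> X \<and> indep J"
  have "\<exists>J. ?P J \<and> (\<forall>K. ?P K \<longrightarrow> card K \<le> card J)"
    by (rule ex_has_greatest_nat[where b = "rank_of indep X + 1" and k = I])
      (use assms card_le_rank in \<open>auto simp: less_Suc_eq_le\<close>)
  then obtain J where J: "?P J" and max: "\<And>K. ?P K \<Longrightarrow> card K \<le> card J" by blast
  have "card J = rank_of indep X"
  proof (rule ccontr)
    assume "card J \<noteq> rank_of indep X"
    then have less: "card J < rank_of indep X" using J card_le_rank[of J X] by simp
    obtain K where K: "K \<subseteq> X" "indep K" "card K = rank_of indep X" by (rule rank_witness)
    then obtain y where y: "y \<in> K - J" "indep (insert y J)"
      using indep_augment[of J K] J less by auto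
    then have "?P (insert y J)" using J K by auto
    then have "card (insert y J) \<le> card J" by (rule max)
    then show False using y J finite_indep by simp
  qed
  then show ?thesis using that J by blast
qed

text \<open>Closure is monotone: an element spanned by a set is spanned by every larger one.\<close>

lemma spanned_mono:
  assumes "rank_of indep (insert x X) = rank_of indep X" "X \<subseteq> Y"
  shows "rank_of indep (insert x Y) = rank_of indep Y"
proof (rule ccontr)
  assume "rank_of indep (insert x Y) \<noteq> rank_of indep Y"
  then have less: "rank_of indep Y < rank_of indep (insert x Y)"
    using rank_mono[OF subset_insertI] by (simp add: nat_less_le)
  obtain I where I: "I \<subseteq> X" "indep I" "card I = rank_of indep X" by (rule rank_witness)
  obtain J where J: "I \<subseteq> J" "J \<subseteq> Y" "indep J" "card J = rank_of indep Y"
    using extend_to_rank[OF I(2) subset_trans[OF I(1) assms(2)]] .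
  obtain K where K: "K \<subseteq> insert x Y" "indep K" "card K = rank_of indep (insert x Y)"
    by (rule rank_witness)
  then obtain y where y: "y \<in> K - J" "indep (insert y J)"
    using indep_augment[of J K] J less by auto
  have "y = x"
  proof (rule ccontr)
    assume "y \<noteq> x"
    then have "card (insert y J) \<le> rank_of indep Y"
      using y K J by (intro card_le_rank) auto
    then show False using y J finite_indep by simp
  qed
  then have "indep (insert x I)" "x \<notin> I" using y J indep_subset[of "insert y J" "insert x I"] by auto
  then have "card I + 1 \<le> rank_of indep (insert x X)"
    using card_le_rank[of "insert x I" "insert x X"] I finite_indep by auto
  then show False using I assms(1) by simp
qed

lemma basis_iff_card: "basis indep B \<longleftrightarrow> indep B \<and> card B = rank_of indep E"
proof
  assume B: "basis indep B"
  then have "indep B" by (simp add: basis_def)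
  obtain J where J: "B \<subseteq> J" "indep J" "card J = rank_of indep E"
    using extend_to_rank[OF \<open>indep B\<close> indep_subset_ground[OF \<open>indep B\<close>]] .
  then show "indep B \<and> card B = rank_of indep E" using B by (auto simp: basis_def)
next
  assume B: "indep B \<and> card B = rank_of indep E"
  then show "basis indep B" unfolding basis_def
    using card_le_rank[OF indep_subset_ground] card_seteq[OF finite_indep] by metis
qed

lemma dual_indep_iff:
  assumes "X \<subseteq> E"
  shows "dual_indep E indep X \<longleftrightarrow> rank_of indep (E - X) = rank_of indep E"
proof
  assume "dual_indep E indep X"
  then obtain B where "basis indep B" "B \<subseteq> E - X"
    unfolding dual_indep_def using basis_iff_card indep_subset_ground by blast
  then show "rank_of indep (E - X) = rank_of indep E"
    by (metis basis_iff_card card_le_rank Diff_subset le_antisym rank_mono)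
next
  assume eq: "rank_of indep (E - X) = rank_of indep E"
  obtain B where B: "B \<subseteq> E - X" "indep B" "card B = rank_of indep (E - X)" by (rule rank_witness)
  then have "X \<subseteq> E - B" using assms by blast
  then show "dual_indep E indep X"
    unfolding dual_indep_def basis_iff_card using eq B by auto
qed

lemma circuit_spans:
  assumes "circuit E indep C" "x \<in> C" "C - {x} \<subseteq> X"
  shows "rank_of indep (insert x X) = rank_of indep X"
proof -
  have fin: "finite C" using assms(1) finite_ground finite_subset by (auto simp: circuit_def)
  have "indep (C - {x})" using assms by (auto simp: circuit_def)
  then have 1: "rank_of indep (C - {x}) = card C - 1"
    using rank_indep assms(2) fin by (simp add: card_Diff_singleton)
  obtain I where I: "I \<subseteq> C" "indep I" "card I = rank_of indep C" by (rule rank_witness)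
  then have "I \<subset> C" using assms(1) by (auto simp: circuit_def)
  then have "card I < card C" using fin by (rule psubset_card_mono[rotated])
  then have "rank_of indep C = rank_of indep (C - {x})"
    using 1 I rank_mono[of "C - {x}" C] by auto
  then have "rank_of indep (insert x (C - {x})) = rank_of indep (C - {x})"
    using assms(2) by (simp add: insert_absorb)
  then show ?thesis using assms(3) by (rule spanned_mono)
qed

text \<open>The complement of a cocircuit is a hyperplane, so it spans no element of the cocircuit, and
  neither does any set avoiding the cocircuit.\<close>

lemma cocircuit_avoided:
  assumes "cocircuit E indep D" "x \<in> D" "X \<subseteq> E - D"
  shows "rank_of indep (insert x X) = rank_of indep X + 1"
proof (rule ccontr)
  assume "rank_of indep (insert x X) \<noteq> rank_of indep X + 1"
  then have "rank_of indep (insert x X) = rank_of indep X"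
    using rank_insert_le[of x X] rank_mono[OF subset_insertI, of X x] by linarith
  then have eq: "rank_of indep (insert x (E - D)) = rank_of indep (E - D)"
    using assms(3) by (rule spanned_mono)
  have D: "D \<subseteq> E" "\<not> dual_indep E indep D" "dual_indep E indep (D - {x})"
    using assms(1,2) by (auto simp: cocircuit_def circuit_def)
  moreover have "E - (D - {x}) = insert x (E - D)" using D assms(2) by blast
  ultimately show False using eq dual_indep_iff[of D] dual_indep_iff[of "D - {x}"] by auto
qed

lemma rank_delete_part_of_cocircuit:
  assumes "cocircuit E indep D" "X \<subset> D"
  shows "rank_of indep (E - X) = rank_of indep E"
  using assms dual_indep_iff[of X] by (auto simp: cocircuit_def circuit_def)

end


section \<open>Cyclic orderings by position\<close>

definition evens :: "nat set \<Rightarrow> nat" where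
  "evens A = card {x \<in> A. even x}"

lemma evens_insert:
  assumes "finite A" "x \<notin> A"
  shows "evens (insert x A) = evens A + (if even x then 1 else 0)"
proof -
  have "{y \<in> insert x A. even y} = (if even x then insert x {y \<in> A. even y} else {y \<in> A. even y})"
    by auto
  then show ?thesis using assms by (simp add: evens_def)
qed

lemma evens_Un: "finite A \<Longrightarrow> finite B \<Longrightarrow> A \<inter> B = {} \<Longrightarrow> evens (A \<union> B) = evens A + evens B"
  unfolding evens_def by (subst card_Un_disjoint [symmetric]) (auto intro: arg_cong[where f = card])

lemma evens_interval: "evens {a..<a + 2 * k} = k"
proof (induction k)
  case (Suc k)
  have "{a..<a + 2 * Suc k} = insert (a + 2 * k + 1) (insert (a + 2 * k) {a..<a + 2 * k})" by auto
  then show ?case using Suc by (simp add: evens_insert)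
qed (simp add: evens_def)

text \<open>The element at position \<open>i\<close> is \<open>e i\<close>, for all natural numbers \<open>i\<close>, with period \<open>n\<close>.  As \<open>n\<close> is even,
  the parity of a position depends only on its element.\<close>

locale cyclic_matroid = matroid E indep
  for E :: "'a set" and indep +
  fixes e :: "nat \<Rightarrow> 'a" and n h :: nat
  assumes period: "e (i + n) = e i"
    and inj: "inj_on e {0..<n}"
    and range: "e ` {0..<n} = E"
    and h_pos: "1 \<le> h"
    and even_n: "even n"
    and n_ge: "4 * h \<le> n"
    and circuit_at: "odd i \<Longrightarrow> circuit E indep (e ` {i..<i + (2 * h + 1)})"
    and cocircuit_at: "even i \<Longrightarrow> cocircuit E indep (e ` {i..<i + (2 * h + 1)})"
begin

abbreviation rk :: "nat set \<Rightarrow> nat" where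
  "rk A \<equiv> rank_of indep (e ` A)"

lemma e_mod: "e (i mod n) = e i"
proof -
  have "e (j + k * n) = e j" for j k
  proof (induction k)
    case (Suc k)
    have "j + Suc k * n = (j + k * n) + n" by simp
    then show ?case using Suc period by metis
  qed simp
  from this[of "i mod n" "i div n"] show ?thesis by (simp add: mult.commute)
qed

lemma n_pos: "0 < n"
  using n_ge h_pos by linarith

lemma e_eq_iff: "e i = e j \<longleftrightarrow> i mod n = j mod n"
  by (metis e_mod inj inj_onD n_pos atLeastLessThan_iff mod_less_divisor zero_le)

lemma e_in_E: "e i \<in> E"
  using range e_mod[of i] n_pos by (metis atLeastLessThan_iff imageI mod_less_divisor zero_le)

lemma e_neq: "i < j \<Longrightarrow> j < i + n \<Longrightarrow> e i \<noteq> e j"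
proof
  assume "i < j" "j < i + n" "e i = e j"
  then have "n dvd j - i" using e_eq_iff mod_eq_dvd_iff_nat[of i j n] by simp
  then show False using \<open>i < j\<close> \<open>j < i + n\<close> by (auto dest: dvd_imp_le)
qed

lemma range_window: "e ` {a..<a + n} = E"
proof
  show "E \<subseteq> e ` {a..<a + n}"
  proof
    fix x assume "x \<in> E"
    then obtain i where i: "x = e i" "i < n" using range by auto
    define j where "j = a + (i + n * a - a) mod n"
    have "1 * a \<le> n * a" using n_pos by (intro mult_le_mono1) simp
    then have "a + (i + n * a - a) = i + n * a" by linarith
    then have "j mod n = i mod n"
      unfolding j_def mod_add_right_eq by simp
    moreover have "j \<in> {a..<a + n}" using n_pos by (simp add: j_def)
    ultimately show "x \<in> e ` {a..<a + n}" using i e_eq_iff by (metis imageI)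
  qed
qed (use e_in_E in auto)

text \<open>The window of positions \<open>v, \<dots>, v + 2 * h\<close> is a cocircuit.  The last premise says that \<open>A\<close> misses
  it also after going round the cycle, so that \<open>u\<close> lies outside the closure of \<open>A\<close>.\<close>

lemma rank_step:
  assumes "even v" "v \<le> u" "u \<le> v + 2 * h"
    and "\<And>x. x \<in> A \<Longrightarrow> v + 2 * h < x \<and> x < v + n \<or> x < v \<and> v + 2 * h < x + n"
  shows "rk (insert u A) = rk A + 1"
proof -
  have "e x \<noteq> e y" if x: "x \<in> A" and y: "y \<in> {v..<v + (2 * h + 1)}" for x y
    using assms(4)[OF x] y e_neq[of x y] e_neq[of y x] by fastforce
  then have "e ` A \<subseteq> E - e ` {v..<v + (2 * h + 1)}" by (auto simp: e_in_E)
  moreover have "e u \<in> e ` {v..<v + (2 * h + 1)}" using assms by auto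
  ultimately show ?thesis using cocircuit_avoided[OF cocircuit_at[OF assms(1)]] by simp
qed

text \<open>An even position to the right of everything so far begins a cocircuit that lies ahead, hence
  raises the rank.  The bound on \<open>hi\<close> keeps this cocircuit from reaching round to \<open>lo + n\<close>.\<close>

lemma rank_grow_right:
  assumes "A \<subseteq> {lo..<s}" "B \<subseteq> {s..<hi}" "lo \<le> s" "hi + 2 * h \<le> lo + n"
  shows "rk A + evens B \<le> rk (A \<union> B)"
  using assms(2,4)
proof (induction hi arbitrary: B)
  case 0
  then show ?case by (simp add: evens_def)
next
  case (Suc hi)
  show ?case
  proof (cases "hi \<in> B")
    case False
    then have "B \<subseteq> {s..<hi}" using Suc.prems less_Suc_eq by fastforce
    then show ?thesis using Suc by simp
  next
    case True
    define B' where "B' = B - {hi}"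
    have B: "B = insert hi B'" "hi \<notin> B'" "finite B'" and sub: "B' \<subseteq> {s..<hi}"
      using True Suc.prems finite_subset[OF Suc.prems(1)]
      by (auto simp: B'_def less_Suc_eq)
    have IH: "rk A + evens B' \<le> rk (A \<union> B')" using Suc sub by simp
    show ?thesis
    proof (cases "even hi")
      case True
      have "rk (insert hi (A \<union> B')) = rk (A \<union> B') + 1"
      proof (rule rank_step[OF True])
        fix x assume "x \<in> A \<union> B'"
        then show "hi + 2 * h < x \<and> x < hi + n \<or> x < hi \<and> hi + 2 * h < x + n"
        proof
          assume "x \<in> A"
          then have "lo \<le> x" "x < s" using assms(1) by auto
          moreover have "s \<le> hi" using Suc.prems(1) \<open>hi \<in> B\<close> by auto
          ultimately show ?thesis using Suc.prems(2) by linarith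
        next
          assume "x \<in> B'"
          then have "s \<le> x" "x < hi" using sub by auto
          then show ?thesis using Suc.prems(2) assms(3) by linarith
        qed
      qed auto
      then show ?thesis using IH B True by (simp add: evens_insert)
    next
      case False
      then have "rk A + evens B = rk A + evens B'" using B by (simp add: evens_insert)
      also have "\<dots> \<le> rk (A \<union> B')" by (rule IH)
      also have "\<dots> \<le> rk (A \<union> B)" using B by (intro rank_mono) auto
      finally show ?thesis .
    qed
  qed
qed

text \<open>The window is independent, being a proper part of a circuit that begins at \<open>a\<close> or just before
  it, according to the parity of \<open>a\<close>.\<close>

lemma rank_window: "rk {a..<a + 2 * h} = evens {a..<a + 2 * h} + h"
proof -
  \<comment> \<open>For even \<open>a\<close> this is the position before \<open>a\<close>; adding \<open>n\<close> covers \<open>a = 0\<close>.\<close>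
  define i where "i = (if odd a then a else a + n - 1)"
  have "odd i" using even_n n_pos by (auto simp: i_def)
  have proper: "e ` {a..<a + 2 * h} \<subset> e ` {i..<i + (2 * h + 1)}"
  proof (cases "odd a")
    case True
    have "e (a + 2 * h) \<notin> e ` {a..<a + 2 * h}"
      using e_neq n_ge h_pos by fastforce
    moreover have "e (a + 2 * h) \<in> e ` {i..<i + (2 * h + 1)}" using True by (simp add: i_def)
    moreover have "e ` {a..<a + 2 * h} \<subseteq> e ` {i..<i + (2 * h + 1)}"
      using True by (intro image_mono) (auto simp: i_def)
    ultimately show ?thesis by blast
  next
    case False
    have "e i \<notin> e ` {a..<a + 2 * h}"
    proof
      assume "e i \<in> e ` {a..<a + 2 * h}"
      then obtain y where "y \<in> {a..<a + 2 * h}" "e i = e y" by auto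
      moreover have "y < i" using \<open>y \<in> _\<close> n_ge h_pos False by (auto simp: i_def)
      moreover have "i < y + n" using \<open>y \<in> _\<close> n_pos False by (auto simp: i_def)
      ultimately show False using e_neq[of y i] by auto
    qed
    moreover have "e i \<in> e ` {i..<i + (2 * h + 1)}" by simp
    moreover have "e ` {a..<a + 2 * h} \<subseteq> e ` {i..<i + (2 * h + 1)}"
    proof (rule image_subsetI)
      fix y assume "y \<in> {a..<a + 2 * h}"
      then have "y + n \<in> {i..<i + (2 * h + 1)}" using False n_pos by (auto simp: i_def)
      then show "e y \<in> e ` {i..<i + (2 * h + 1)}" using period[of y] by (metis imageI)
    qed
    ultimately show ?thesis by blast
  qed
  then have "indep (e ` {a..<a + 2 * h})"
    using circuit_at[OF \<open>odd i\<close>] unfolding circuit_def by blast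
  then have "rk {a..<a + 2 * h} = card (e ` {a..<a + 2 * h})" by (rule rank_indep)
  also have "\<dots> = 2 * h"
  proof (subst card_image)
    show "inj_on e {a..<a + 2 * h}"
    proof (rule linorder_inj_onI)
      fix x y assume "x < y" "x \<in> {a..<a + 2 * h}" "y \<in> {a..<a + 2 * h}"
      then show "e x \<noteq> e y" using e_neq[of x y] n_ge by auto
    qed auto
  qed simp
  finally show ?thesis by (simp add: evens_interval)
qed

text \<open>An interval that grows by an odd position ends with a whole circuit, so only even positions can
  raise its rank.\<close>

lemma rank_interval_le: "rk {a..<a + (2 * h + l)} \<le> evens {a..<a + (2 * h + l)} + h"
proof (induction l)
  case 0
  show ?case by (simp add: rank_window)
next
  case (Suc l)
  let ?A = "{a..<a + (2 * h + l)}" and ?u = "a + (2 * h + l)"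
  have split: "{a..<a + (2 * h + Suc l)} = insert ?u ?A" by auto
  show ?case
  proof (cases "even ?u")
    case True
    then show ?thesis
      using Suc rank_insert_le[of "e ?u" "e ` ?A"] unfolding split by (simp add: evens_insert)
  next
    case False
    have "rank_of indep (insert (e ?u) (e ` ?A)) = rk ?A"
    proof (rule circuit_spans)
      show "circuit E indep (e ` {a + l..<a + l + (2 * h + 1)})"
        using False by (intro circuit_at) auto
      have "{a + l..<a + l + (2 * h + 1)} \<subseteq> insert ?u ?A" by auto
      then show "e ` {a + l..<a + l + (2 * h + 1)} - {e ?u} \<subseteq> e ` ?A" by blast
    qed auto
    then show ?thesis using Suc False unfolding split by (simp add: evens_insert)
  qed
qed

text \<open>Leaving out \<open>2 * h\<close> consecutive positions does not lower the rank, since they are a proper part of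
  a cocircuit; what remains is an interval to which both estimates above apply.\<close>

lemma rank_ground: "rank_of indep E = n div 2"
proof -
  define l where "l = n - 4 * h"
  have l: "n = 2 * h + (2 * h + l)" using n_ge by (simp add: l_def)
  obtain k where k: "l = 2 * k" using even_n l by auto
  let ?A = "{0..<2 * h + l}"
  have "rk {0..<2 * h} + evens {2 * h..<2 * h + l} \<le> rk ({0..<2 * h} \<union> {2 * h..<2 * h + l})"
    by (rule rank_grow_right[of _ 0]) (use l in auto)
  moreover have "{0..<2 * h} \<union> {2 * h..<2 * h + l} = ?A" by auto
  ultimately have "rk ?A = 2 * h + k"
    using rank_interval_le[of 0 l] evens_interval[of 0 "h + k"] evens_interval[of "2 * h" k]
      rank_window[of 0] evens_interval[of 0 h] by (simp add: k)
  moreover have "rank_of indep (E - e ` {2 * h + l..<n}) = rank_of indep E"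
  proof (rule rank_delete_part_of_cocircuit)
    let ?v = "2 * h + l"
    show "cocircuit E indep (e ` {?v..<?v + (2 * h + 1)})"
      by (rule cocircuit_at) (simp add: k)
    have "e (?v + 2 * h) \<notin> e ` {?v..<n}" using e_neq l by fastforce
    moreover have "e (?v + 2 * h) \<in> e ` {?v..<?v + (2 * h + 1)}" by simp
    moreover have "e ` {?v..<n} \<subseteq> e ` {?v..<?v + (2 * h + 1)}"
      using l by (intro image_mono) auto
    ultimately show "e ` {?v..<n} \<subset> e ` {?v..<?v + (2 * h + 1)}" by blast
  qed
  moreover have "E - e ` {2 * h + l..<n} = e ` ?A"
  proof -
    have "e ` {0..<n} - e ` {2 * h + l..<n} = e ` ({0..<n} - {2 * h + l..<n})"
      using inj by (subst inj_on_image_set_diff) auto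
    moreover have "{0..<n} - {2 * h + l..<n} = ?A" using l by auto
    ultimately show ?thesis using range by simp
  qed
  ultimately show ?thesis using l k by simp
qed

end

section \<open>Unions of petals\<close>

text \<open>Petals are numbered by all natural numbers too, with period \<open>m\<close>: petal \<open>j\<close> occupies the positions
  from \<open>b j\<close> up to the next boundary.  A set of petals that does not contain all of them can then be
  read off in a window beginning with any of its members, without a distinguished cut.\<close>

locale petal_ordering = cyclic_matroid E indep e n h
  for E :: "'a set" and indep e n h +
  fixes b :: "nat \<Rightarrow> nat" and m :: nat
  assumes b_period: "b (j + m) = b j + n"
    and b_gap: "b j + 2 * h \<le> b (Suc j)"
begin

definition positions :: "nat set \<Rightarrow> nat set" where
  "positions J = (\<Union>j\<in>J. {b j..<b (Suc j)})"

lemma b_mono: "i \<le> j \<Longrightarrow> b i \<le> b j"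
  by (rule lift_Suc_mono_le[of b]) (use b_gap add_leD1 in blast)+

lemma b_gap_less: "i < j \<Longrightarrow> b i + 2 * h \<le> b j"
  using b_gap[of i] b_mono[of "Suc i" j] by simp

lemma b_before_wrap: "Suc r \<le> p + m \<Longrightarrow> b r + 2 * h \<le> b p + n"
  using b_gap_less[of r "p + m"] b_period by simp

lemma positions_Un: "positions (J \<union> K) = positions J \<union> positions K"
  by (auto simp: positions_def)

lemma positions_subset:
  assumes "J \<subseteq> {p..<q}"
  shows "positions J \<subseteq> {b p..<b q}"
proof
  fix x assume "x \<in> positions J"
  then obtain j where "j \<in> J" "b j \<le> x" "x < b (Suc j)" by (auto simp: positions_def)
  then show "x \<in> {b p..<b q}" using assms b_mono[of p j] b_mono[of "Suc j" q] by force
qed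

lemma positions_interval: "p \<le> q \<Longrightarrow> positions {p..<q} = {b p..<b q}"
proof (induction rule: dec_induct)
  case base
  show ?case by (simp add: positions_def)
next
  case (step q)
  have "positions {p..<Suc q} = positions {p..<q} \<union> {b q..<b (Suc q)}"
    using step(1) by (auto simp: positions_def less_Suc_eq)
  then show ?case using step b_mono[of p q] b_mono[of q "Suc q"] by auto
qed

lemma positions_disjoint:
  assumes "J \<inter> K = {}"
  shows "positions J \<inter> positions K = {}"
proof -
  have "{b j..<b (Suc j)} \<inter> {b k..<b (Suc k)} = {}" if "j \<in> J" "k \<in> K" for j k
  proof -
    have "j < k \<or> k < j" using assms that by (metis IntI empty_iff nat_neq_iff)
    then show ?thesis using b_mono[of "Suc j" k] b_mono[of "Suc k" j] by auto
  qed
  then show ?thesis by (fastforce simp: positions_def)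
qed

lemma finite_positions: "finite J \<Longrightarrow> finite (positions J)"
  by (simp add: positions_def)

lemma evens_positions_Un:
  "finite J \<Longrightarrow> finite K \<Longrightarrow> J \<inter> K = {} \<Longrightarrow>
    evens (positions (J \<union> K)) = evens (positions J) + evens (positions K)"
  by (simp add: positions_Un evens_Un finite_positions positions_disjoint)

text \<open>The first \<open>2 * h\<close> positions of petal \<open>p\<close> are independent, and each further even position raises the
  rank.  As petal \<open>p + m - 1\<close> is not in \<open>J\<close>, the last of the cocircuits used does not reach round to
  petal \<open>p\<close>.\<close>

lemma rank_petals_ge:
  assumes J: "J \<subseteq> {p..<r}" "Suc r \<le> p + m" "p \<in> J"
  shows "evens (positions J) + h \<le> rk (positions J)"
proof -
  let ?A = "{b p..<b p + 2 * h}" and ?B = "positions J - {b p..<b p + 2 * h}"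
  have "finite J" using J(1) finite_subset by blast
  have A: "?A \<subseteq> positions J" using J(3) b_gap[of p] by (force simp: positions_def)
  have "rk ?A + evens ?B \<le> rk (?A \<union> ?B)"
  proof (rule rank_grow_right)
    show "?B \<subseteq> {b p + 2 * h..<b r}" using positions_subset[OF J(1)] by auto
    show "b r + 2 * h \<le> b p + n" using J(2) by (rule b_before_wrap)
  qed auto
  moreover have "evens (?A \<union> ?B) = evens ?A + evens ?B"
    using \<open>finite J\<close> finite_positions by (intro evens_Un) auto
  moreover have "?A \<union> ?B = positions J" using A by blast
  ultimately show ?thesis using rank_window[of "b p"] by simp
qed

text \<open>Petal \<open>q\<close> follows a gap.  Its first odd position lies in a cocircuit that misses everything to
  the left of the gap, so it raises the rank although it contributes nothing to \<open>evens\<close>.  If petal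
  \<open>q\<close> begins with an even position \<open>s\<close>, then \<open>s + 1\<close> has to be added before \<open>s\<close>, and \<open>s\<close> afterwards with
  the cocircuit that ends at \<open>s\<close> and lies in the gap otherwise.\<close>

lemma rank_petals_gap_ge:
  assumes J: "J \<subseteq> {p..<r}" "Suc r \<le> p + m" "p \<in> J"
    and q: "q \<in> J" "p < q" "q - 1 \<notin> J"
  shows "evens (positions J) + h + 1 \<le> rk (positions J)"
proof -
  define s where "s = b q"
  \<comment> \<open>The interval from \<open>s\<close> to \<open>c - 1\<close> ends with the first odd position of petal \<open>q\<close>.\<close>
  define c where "c = (if odd s then s + 1 else s + 2)"
  define A where "A = positions (J \<inter> {..<q})"
  define B where "B = positions (J \<inter> {q..}) - {s..<c}"
  have finJ: "finite J" using J(1) finite_subset by blast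
  have J1: "J \<inter> {..<q} \<subseteq> {p..<q - 1}"
  proof
    fix j assume "j \<in> J \<inter> {..<q}"
    moreover from this have "j \<noteq> q - 1" using q(3) by auto
    ultimately show "j \<in> {p..<q - 1}" using J(1) by auto
  qed
  have Asub: "A \<subseteq> {b p..<b (q - 1)}" unfolding A_def by (rule positions_subset[OF J1])
  have gap: "b (q - 1) + 2 * h \<le> s" using b_gap_less[of "q - 1" q] q(2) by (simp add: s_def)
  have c: "s < c" "c \<le> s + 2 * h" "c \<le> b (Suc q)" "Suc q \<le> r"
    using h_pos b_gap[of q] J(1) q(1) by (auto simp: c_def s_def)
  have wrap: "b r + 2 * h \<le> b p + n" using J(2) by (rule b_before_wrap)
  have "b (Suc q) \<le> b r" using c b_mono by blast
  have ineq: "s + 2 * h < x + n \<and> x + 2 * h < s" if "x \<in> A" for x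
    using that Asub gap wrap \<open>b (Suc q) \<le> b r\<close> c by fastforce
  have p_A: "evens A + h \<le> rk A"
    unfolding A_def using J1 J(2,3) c(4) q(2) by (intro rank_petals_ge[of _ p "q - 1"]) auto
  have start: "rk A + evens {s..<c} + 1 \<le> rk (A \<union> {s..<c})"
  proof (cases "odd s")
    case True
    have "rk (insert s A) = rk A + 1"
    proof (rule rank_step[of "s - 1"])
      fix x assume "x \<in> A"
      then show "s - 1 + 2 * h < x \<and> x < s - 1 + n \<or> x < s - 1 \<and> s - 1 + 2 * h < x + n"
        using ineq[of x] h_pos by auto
    qed (use True h_pos in auto)
    then show ?thesis using True by (simp add: c_def evens_def)
  next
    case False
    have "rk (insert (s + 1) A) = rk A + 1"
    proof (rule rank_step[of s])
      fix x assume "x \<in> A"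
      then show "s + 2 * h < x \<and> x < s + n \<or> x < s \<and> s + 2 * h < x + n"
        using ineq[of x] by auto
    qed (use False h_pos in auto)
    moreover have "rk (insert s (insert (s + 1) A)) = rk (insert (s + 1) A) + 1"
    proof (rule rank_step[of "s - 2 * h"])
      fix x assume "x \<in> insert (s + 1) A"
      then show "s - 2 * h + 2 * h < x \<and> x < s - 2 * h + n \<or> x < s - 2 * h \<and> s - 2 * h + 2 * h < x + n"
        using ineq[of x] gap n_ge h_pos by auto
    qed (use False gap in auto)
    moreover have "A \<union> {s..<c} = insert s (insert (s + 1) A)" using False by (auto simp: c_def)
    moreover have "evens {s..<c} = 1" using evens_interval[of s 1] False by (simp add: c_def)
    ultimately show ?thesis by simp
  qed
  have "rk (A \<union> {s..<c}) + evens B \<le> rk ((A \<union> {s..<c}) \<union> B)"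
  proof (rule rank_grow_right)
    show "A \<union> {s..<c} \<subseteq> {b p..<c}" using Asub gap c b_mono[of p q] q(2) by (auto simp: s_def)
    have "positions (J \<inter> {q..}) \<subseteq> {b q..<b r}" using J(1) by (intro positions_subset) auto
    then show "B \<subseteq> {c..<b r}" by (auto simp: B_def s_def)
    show "b p \<le> c" using b_mono[of p q] q(2) c by (simp add: s_def)
  qed (rule wrap)
  moreover have split: "positions J = A \<union> positions (J \<inter> {q..})"
    unfolding A_def positions_Un [symmetric] by (rule arg_cong[where f = positions]) auto
  have block: "{s..<c} \<subseteq> positions (J \<inter> {q..})"
    using c q(1) by (force simp: positions_def s_def)
  then have "(A \<union> {s..<c}) \<union> B = positions J" using split by (auto simp: B_def)
  moreover have "evens (positions J) = evens A + (evens {s..<c} + evens B)"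
  proof -
    have "evens (positions J) = evens ((positions (J \<inter> {..<q} \<union> J \<inter> {q..})))"
      by (rule arg_cong[where f = "\<lambda>J. evens (positions J)"]) auto
    also have "\<dots> = evens A + evens (positions (J \<inter> {q..}))"
      unfolding A_def using finJ by (intro evens_positions_Un) auto
    also have "positions (J \<inter> {q..}) = {s..<c} \<union> B" using block by (auto simp: B_def)
    also have "evens \<dots> = evens {s..<c} + evens B"
      using finJ by (intro evens_Un) (auto simp: B_def finite_positions)
    finally show ?thesis .
  qed
  ultimately show ?thesis using p_A start by simp
qed

lemma rank_consecutive_petals:
  assumes "p < q" "q < p + m"
  shows "rk (positions {p..<q}) = evens (positions {p..<q}) + h"
proof -
  define l where "l = b q - b p - 2 * h"
  have "b q = b p + (2 * h + l)" using b_gap_less[OF assms(1)] by (simp add: l_def)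
  then have "rk (positions {p..<q}) \<le> evens (positions {p..<q}) + h"
    using rank_interval_le[of "b p" l] assms by (simp add: positions_interval)
  moreover have "evens (positions {p..<q}) + h \<le> rk (positions {p..<q})"
    using assms by (intro rank_petals_ge[of _ p q]) auto
  ultimately show ?thesis by simp
qed

lemma all_positions: "positions {p..<p + m} = {b p..<b p + n}"
  by (simp add: positions_interval b_period)

lemma complement_petals:
  assumes "J \<subseteq> {p..<p + m}"
  shows "E - e ` positions J = e ` positions ({p..<p + m} - J)"
proof -
  have sub: "positions J \<subseteq> {b p..<b p + n}" using positions_subset[OF assms] by (simp add: b_period)
  have inj: "inj_on e {b p..<b p + n}"
  proof (rule linorder_inj_onI)
    fix x y assume "x < y" "x \<in> {b p..<b p + n}" "y \<in> {b p..<b p + n}"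
    then show "e x \<noteq> e y" using e_neq[of x y] by auto
  qed auto
  have "E - e ` positions J = e ` ({b p..<b p + n} - positions J)"
    unfolding inj_on_image_set_diff[OF inj Diff_subset sub] range_window ..
  moreover have "positions {p..<p + m} = positions J \<union> positions ({p..<p + m} - J)"
    unfolding positions_Un [symmetric] using assms by (intro arg_cong[where f = positions]) auto
  then have "{b p..<b p + n} - positions J = positions ({p..<p + m} - J)"
    using positions_disjoint[of J "{p..<p + m} - J"] unfolding all_positions by blast
  ultimately show ?thesis by simp
qed

lemma evens_complement_petals:
  assumes "J \<subseteq> {p..<p + m}"
  shows "evens (positions J) + evens (positions ({p..<p + m} - J)) = n div 2"
proof -
  have "evens (positions {p..<p + m}) = evens (positions (J \<union> ({p..<p + m} - J)))"
    using assms by (intro arg_cong[where f = "\<lambda>J. evens (positions J)"]) auto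
  also have "\<dots> = evens (positions J) + evens (positions ({p..<p + m} - J))"
    using assms finite_subset by (intro evens_positions_Un) auto
  finally show ?thesis
    using evens_interval[of "b p" "n div 2"] even_n by (simp add: all_positions)
qed

lemma connectivity_consecutive_petals:
  assumes "p < q" "q < p + m"
  shows "connectivity E indep (e ` positions {p..<q}) = 2 * int h"
proof -
  have comp: "{p..<p + m} - {p..<q} = {q..<p + m}" using assms by auto
  have "rk (positions {p..<q}) + rk (positions {q..<p + m}) = n div 2 + 2 * h"
    using rank_consecutive_petals[of p q] rank_consecutive_petals[of q "p + m"] assms
      evens_complement_petals[of "{p..<q}" p] by (simp add: comp)
  then show ?thesis
    unfolding connectivity_def using complement_petals[of "{p..<q}" p] assms rank_ground
    by (simp add: comp)
qed

text \<open>Both \<open>J\<close> and its complement reach the rank of an interval with the same number of even positions,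
  and the gap before petal \<open>q\<close> lets \<open>J\<close> exceed it.\<close>

lemma connectivity_gap_petals:
  assumes J: "J \<subseteq> {p..<r}" "Suc r = p + m" "p \<in> J"
    and q: "q \<in> J" "p < q" "q - 1 \<notin> J"
  shows "2 * int h < connectivity E indep (e ` positions J)"
proof -
  define K where "K = {p..<p + m} - J"
  \<comment> \<open>A window for the complement must begin with one of its own petals.\<close>
  define k where "k = Min K"
  have J': "J \<subseteq> {p..<p + m}" using J(1,2) by fastforce
  have "finite K" "r \<in> K" using J by (auto simp: K_def)
  then have k: "k \<in> K" "\<And>j. j \<in> K \<Longrightarrow> k \<le> j"
    unfolding k_def by (auto intro!: Min_in Min_le)
  then have "p < k" "K \<subseteq> {k..<p + m}" using J(3) nat_less_le by (auto simp: K_def)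
  then have "evens (positions K) + h \<le> rk (positions K)"
    using k by (intro rank_petals_ge) auto
  moreover have "evens (positions J) + h + 1 \<le> rk (positions J)"
    using J q by (intro rank_petals_gap_ge[of J p r q]) auto
  moreover have "evens (positions J) + evens (positions K) = n div 2"
    using evens_complement_petals[OF J'] by (simp add: K_def)
  moreover have "E - e ` positions J = e ` positions K"
    using complement_petals[OF J'] by (simp add: K_def)
  ultimately show ?thesis unfolding connectivity_def rank_ground by simp
qed

lemma local_connectivity_adjacent_petals:
  assumes "3 \<le> m"
  shows "local_connectivity indep (e ` positions {p}) (e ` positions {Suc p}) = int h"
proof -
  have one: "rk (positions {j}) = evens (positions {j}) + h" for j
    using rank_consecutive_petals[of j "Suc j"] assms by simp
  have two: "{p..<Suc (Suc p)} = {p} \<union> {Suc p}" by auto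
  have "rk (positions ({p} \<union> {Suc p})) = evens (positions ({p} \<union> {Suc p})) + h"
    using rank_consecutive_petals[of p "Suc (Suc p)"] assms unfolding two by simp
  moreover have "evens (positions ({p} \<union> {Suc p})) = evens (positions {p}) + evens (positions {Suc p})"
    by (rule evens_positions_Un) auto
  ultimately show ?thesis
    unfolding local_connectivity_def image_Un [symmetric] positions_Un [symmetric] one by simp
qed

lemma local_connectivity_distant_petals:
  assumes "Suc p < q" "Suc q < p + m"
  shows "local_connectivity indep (e ` positions {p}) (e ` positions {q}) \<le> int h - 1"
proof -
  have one: "rk (positions {j}) = evens (positions {j}) + h" for j
    using rank_consecutive_petals[of j "Suc j"] assms by simp
  have "evens (positions ({p} \<union> {q})) + h + 1 \<le> rk (positions ({p} \<union> {q}))"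
    using assms by (intro rank_petals_gap_ge[of _ p "p + m - 1" q]) auto
  moreover have "evens (positions ({p} \<union> {q})) = evens (positions {p}) + evens (positions {q})"
    using assms by (intro evens_positions_Un) auto
  ultimately show ?thesis
    unfolding local_connectivity_def image_Un [symmetric] positions_Un [symmetric] one by simp
qed

end


section \<open>Consecutive sets of subscripts\<close>

lemma cyc_Suc: "xs \<noteq> [] \<Longrightarrow> cyc xs (Suc j) = xs ! (j mod length xs)"
  by (simp add: cyc_def)

text \<open>Petal \<open>j\<close> has the one-based subscript \<open>Suc (j mod m)\<close>.\<close>

lemma consecutive_set_iff:
  assumes "1 \<le> m"
  shows "consecutive_set m I \<longleftrightarrow> (\<exists>p l. I = (\<lambda>j. Suc (j mod m)) ` {p..<p + l})"
proof -
  have *: "{j \<in> {1..m}. \<exists>d<l. j mod m = (a + d) mod m} = (\<lambda>j. Suc (j mod m)) ` {p..<p + l}"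
    if "Suc p mod m = a mod m" for a p l
  proof (intro subset_antisym subsetI)
    fix j assume "j \<in> {j \<in> {1..m}. \<exists>d<l. j mod m = (a + d) mod m}"
    then obtain d where d: "1 \<le> j" "j \<le> m" "d < l" "j mod m = (a + d) mod m" by auto
    then have "Suc (j - 1) mod m = Suc (p + d) mod m"
      using that by (metis Suc_diff_1 add_Suc less_eq_Suc_le mod_add_left_eq One_nat_def)
    then have "(j - 1) mod m = (p + d) mod m"
      by (auto simp: mod_Suc split: if_splits)
    then have "j = Suc ((p + d) mod m)" using d by simp
    then show "j \<in> (\<lambda>j. Suc (j mod m)) ` {p..<p + l}" using d by auto
  next
    fix j assume "j \<in> (\<lambda>j. Suc (j mod m)) ` {p..<p + l}"
    then obtain x where x: "p \<le> x" "x < p + l" "j = Suc (x mod m)" by auto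
    then have "j mod m = Suc x mod m" by (simp add: mod_Suc_eq)
    also have "\<dots> = (Suc p + (x - p)) mod m" using x by simp
    also have "\<dots> = (a + (x - p)) mod m" using that by (metis mod_add_left_eq)
    finally have "j mod m = (a + (x - p)) mod m" .
    moreover have "j \<in> {1..m}" using x assms by (simp add: Suc_leI)
    moreover have "x - p < l" using x by simp
    ultimately show "j \<in> {j \<in> {1..m}. \<exists>d<l. j mod m = (a + d) mod m}" by blast
  qed
  show ?thesis
  proof
    assume "consecutive_set m I"
    then obtain a l where I: "I = {j \<in> {1..m}. \<exists>d<l. j mod m = (a + d) mod m}"
      unfolding consecutive_set_def by blast
    have "Suc (a + m - 1) mod m = a mod m" using assms by simp
    from I[unfolded *[OF this]] show "\<exists>p l. I = (\<lambda>j. Suc (j mod m)) ` {p..<p + l}" by blast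
  next
    assume "\<exists>p l. I = (\<lambda>j. Suc (j mod m)) ` {p..<p + l}"
    then obtain p l where "I = (\<lambda>j. Suc (j mod m)) ` {p..<p + l}" by blast
    then show "consecutive_set m I"
      unfolding consecutive_set_def *[OF refl, symmetric] by blast
  qed
qed

lemma window_image_residues:
  assumes "1 \<le> m" "m \<le> l"
  shows "(\<lambda>j. Suc (j mod m)) ` {p..<p + l} = {1..m}"
proof (intro subset_antisym subsetI)
  fix i assume i: "i \<in> {1..m}"
  define x where "x = p + (i - 1 + m * p - p) mod m"
  have "1 * p \<le> m * p" using assms by (intro mult_le_mono1)
  then have "p + (i - 1 + m * p - p) = i - 1 + m * p" by linarith
  then have "x mod m = (i - 1 + m * p) mod m" unfolding x_def mod_add_right_eq by simp
  also have "\<dots> = (i - 1) mod m" by (rule mod_mult_self2)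
  also have "\<dots> = i - 1" using i by (intro mod_less) auto
  finally have "x mod m = i - 1" .
  moreover have "(i - 1 + m * p - p) mod m < m" using assms by simp
  then have "x \<in> {p..<p + l}" using assms by (simp add: x_def del: mod_less_divisor)
  ultimately show "i \<in> (\<lambda>j. Suc (j mod m)) ` {p..<p + l}" using i by force
qed (use assms in \<open>auto simp: Suc_leI\<close>)

text \<open>The two cases in the form in which the rank estimates apply.  In the second one, \<open>p\<close> is a member
  whose predecessor is not, so that the window beginning at \<open>p\<close> has a last petal outside \<open>J\<close>; as \<open>J\<close> is
  not an initial segment of this window, some \<open>q\<close> comes after a gap.\<close>

lemma consecutive_set_cases:
  assumes "I \<noteq> {}" "I \<subset> {1..m}"
  obtains
    (consecutive) p q where "consecutive_set m I" "p < q" "q < p + m"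
      "I = (\<lambda>j. Suc (j mod m)) ` {p..<q}"
  | (gap) p q r J where "\<not> consecutive_set m I" "J \<subseteq> {p..<r}" "Suc r = p + m" "p \<in> J"
      "q \<in> J" "p < q" "q - 1 \<notin> J" "I = (\<lambda>j. Suc (j mod m)) ` J"
proof -
  have m: "1 \<le> m" using assms by (cases m) auto
  show ?thesis
  proof (cases "consecutive_set m I")
    case True
    then obtain p l where I: "I = (\<lambda>j. Suc (j mod m)) ` {p..<p + l}"
      using consecutive_set_iff[OF m] by blast
    moreover have "l \<noteq> 0" using I assms(1) by auto
    moreover have "l < m" using window_image_residues[OF m, of l p] I assms(2) by force
    ultimately show ?thesis using consecutive[of p "p + l"] True by simp
  next
    case False
    \<comment> \<open>The periodic set of all natural numbers that stand for a member of \<open>I\<close>.\<close>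
    define S where "S = {j. Suc (j mod m) \<in> I}"
    have S_add: "j + m \<in> S \<longleftrightarrow> j \<in> S" for j by (simp add: S_def)
    obtain x where x: "x \<notin> S"
    proof -
      obtain i where "i \<in> {1..m}" "i \<notin> I" using assms(2) by blast
      then have "i - 1 \<notin> S" by (auto simp: S_def)
      then show ?thesis by (rule that)
    qed
    have S_image: "(\<lambda>j. Suc (j mod m)) ` (S \<inter> {p..<p + m}) = I" for p
    proof -
      have "(\<lambda>j. Suc (j mod m)) ` (S \<inter> {p..<p + m})
          = I \<inter> (\<lambda>j. Suc (j mod m)) ` {p..<p + m}"
        by (auto simp: S_def)
      then show ?thesis using window_image_residues[OF m, of m p] assms(2) by auto
    qed
    have ex: "\<exists>y. y \<in> S \<and> x < y"
    proof -
      have "S \<inter> {Suc x..<Suc x + m} \<noteq> {}" using S_image[of "Suc x"] assms(1) by blast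
      then obtain y where "y \<in> S" "Suc x \<le> y" by auto
      then show ?thesis by (intro exI[of _ y]) simp
    qed
    define p where "p = (LEAST y. y \<in> S \<and> x < y)"
    have p: "p \<in> S" "x < p" using LeastI_ex[OF ex] by (simp_all add: p_def)
    have before: "p - 1 \<notin> S"
    proof
      assume "p - 1 \<in> S"
      then have "x \<noteq> p - 1" using x by auto
      then have "p \<le> p - 1" unfolding p_def
        using \<open>p - 1 \<in> S\<close> p(2) by (intro Least_le) (auto simp: p_def)
      then show False using p(2) by simp
    qed
    define r where "r = p + m - 1"
    have r: "Suc r = p + m" "r \<notin> S"
      using S_add[of "p - 1"] before m p(2) by (simp_all add: r_def)
    define J where "J = S \<inter> {p..<p + m}"
    have J: "J \<subseteq> {p..<r}" using r by (auto simp: J_def less_Suc_eq simp flip: r(1))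
    have "p \<in> J" using p m by (simp add: J_def)
    \<comment> \<open>The first gap begins at \<open>u\<close>, and \<open>q\<close> is the first member behind it.\<close>
    define u where "u = (LEAST y. p \<le> y \<and> y \<notin> J)"
    have u_ex: "\<exists>y. p \<le> y \<and> y \<notin> J" using J r m by (intro exI[of _ r]) auto
    have u: "p \<le> u" "u \<notin> J" using LeastI_ex[OF u_ex] by (simp_all add: u_def)
    have initial: "{p..<u} \<subseteq> J"
    proof
      fix y assume y: "y \<in> {p..<u}"
      then have "\<not> (p \<le> y \<and> y \<notin> J)" unfolding u_def by (intro not_less_Least) auto
      then show "y \<in> J" using y by auto
    qed
    have "J \<noteq> {p..<u}"
    proof
      assume "J = {p..<u}"
      then have "I = (\<lambda>j. Suc (j mod m)) ` {p..<p + (u - p)}"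
        using S_image[of p] u(1) by (simp add: J_def)
      then show False using False consecutive_set_iff[OF m] by blast
    qed
    then obtain z where "z \<in> J" "z \<notin> {p..<u}" using initial by blast
    then have q_ex: "\<exists>y. y \<in> J \<and> u < y"
      using u(2) J by (metis atLeastLessThan_iff linorder_neqE_nat subsetD)
    define q where "q = (LEAST y. y \<in> J \<and> u < y)"
    have q: "q \<in> J" "u < q" using LeastI_ex[OF q_ex] by (simp_all add: q_def)
    have "q - 1 \<notin> J"
    proof
      assume "q - 1 \<in> J"
      then have "u \<noteq> q - 1" using u by auto
      then have "q \<le> q - 1" unfolding q_def
        using \<open>q - 1 \<in> J\<close> q(2) by (intro Least_le) (auto simp: q_def)
      then show False using q(2) by simp
    qed
    then show thesis
      using gap[OF False J r(1) \<open>p \<in> J\<close> q(1) _ \<open>q - 1 \<notin> J\<close>] q(2) u(1) S_image[of p]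
      unfolding J_def by simp
  qed
qed

section \<open>Orderings and concatenations as periodic functions\<close>

lemma cyc_period: "xs \<noteq> [] \<Longrightarrow> cyc xs (i + length xs) = cyc xs i"
proof -
  assume "xs \<noteq> []"
  then have "i + length xs + length xs - 1 = (i + length xs - 1) + length xs"
    by (cases xs) auto
  then show ?thesis by (simp add: cyc_def)
qed

lemma cyc_add_mult: "xs \<noteq> [] \<Longrightarrow> cyc xs (i + length xs * k) = cyc xs i"
proof (induction k)
  case (Suc k)
  have "i + length xs * Suc k = (i + length xs * k) + length xs" by simp
  then show ?case using Suc cyc_period by metis
qed simp

lemma cyc_mod: "xs \<noteq> [] \<Longrightarrow> cyc xs (i mod length xs) = cyc xs i"
  by (metis cyc_add_mult mod_mult_div_eq)

lemma cyc_window_cong: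
  assumes "xs \<noteq> []" "i mod length xs = j mod length xs"
  shows "cyc xs ` {i..<i + l} = cyc xs ` {j..<j + l}"
proof -
  have shift: "{i..<i + l} = (\<lambda>d. i + d) ` {0..<l}" for i :: nat
    using image_add_atLeastLessThan[of i 0 l] by (simp add: add.commute)
  have "cyc xs (i + d) = cyc xs (j + d)" for d
    using assms by (metis cyc_mod mod_add_left_eq)
  then show ?thesis unfolding shift image_image by simp
qed

lemma cyc_bij_betw:
  assumes "distinct xs"
  shows "bij_betw (cyc xs) {0..<length xs} (set xs)"
proof (cases "xs = []")
  case False
  define n where "n = length xs"
  have n: "0 < n" using False by (simp add: n_def)
  have image: "cyc xs ` {0..<n} = set xs"
  proof (intro subset_antisym subsetI)
    fix x assume "x \<in> set xs"
    then obtain i where i: "i < n" "x = xs ! i" by (metis in_set_conv_nth n_def)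
    then have "x = cyc xs (Suc i)" using False by (simp add: cyc_Suc n_def)
    then have "x = cyc xs (Suc i mod n)" using False by (simp add: cyc_mod n_def)
    then show "x \<in> cyc xs ` {0..<n}" using n by simp
  qed (use n in \<open>auto simp: cyc_def n_def\<close>)
  then have "card (cyc xs ` {0..<n}) = card {0..<n}"
    using distinct_card[OF assms] by (simp add: n_def)
  then show ?thesis using image by (simp add: bij_betw_def n_def eq_card_imp_inj_on)
qed (simp add: bij_betw_def)

text \<open>The ordering only provides circuits and cocircuits for odd subscripts up to \<open>n\<close>.  They extend
  periodically because \<open>n\<close> is even.\<close>

lemma (in matroid) cyclic_matroid_of_ordering:
  assumes "1 \<le> h" "odd_cyclic_ordering E indep (2 * h + 1) \<sigma>"
  shows "cyclic_matroid E indep (cyc \<sigma>) (length \<sigma>) h"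
proof -
  define e where "e = cyc \<sigma>"
  define n where "n = length \<sigma>"
  have \<sigma>: "distinct \<sigma>" "set \<sigma> = E" "2 * h + 2 \<le> card E"
    using assms(2) by (auto simp: odd_cyclic_ordering_def)
  have n: "n = card E" "\<sigma> \<noteq> []" using \<sigma> distinct_card[of \<sigma>] by (auto simp: n_def)
  have win: "{i..i + (2 * h + 1) - 1} = {i..<i + (2 * h + 1)}"
    "{i + 1..i + (2 * h + 1)} = {i + 1..<i + 1 + (2 * h + 1)}" for i :: nat by auto
  have ord: "card (e ` {i..<i + (2 * h + 1)}) = 2 * h + 1"
      "circuit E indep (e ` {i..<i + (2 * h + 1)})"
      "card (e ` {i + 1..<i + 1 + (2 * h + 1)}) = 2 * h + 1"
      "cocircuit E indep (e ` {i + 1..<i + 1 + (2 * h + 1)})"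
    if "odd i" "1 \<le> i" "i \<le> n" for i
    using assms(2) that unfolding odd_cyclic_ordering_def e_def n_def win by auto
  have bij: "bij_betw e {0..<n} E" using cyc_bij_betw[OF \<sigma>(1)] \<sigma>(2) by (simp add: e_def n_def)
  \<comment> \<open>A circuit shows that the rank is at least \<open>2 * h\<close>, a cocircuit that the corank is.\<close>
  have n_ge: "4 * h \<le> n"
  proof -
    define C D where "C = e ` {1..<1 + (2 * h + 1)}" and "D = e ` {1 + 1..<1 + 1 + (2 * h + 1)}"
    have C: "card C = 2 * h + 1" "circuit E indep C"
      and D: "card D = 2 * h + 1" "cocircuit E indep D"
      unfolding C_def D_def using n \<sigma>(3) by (intro ord; simp)+
    obtain x where x: "x \<in> C" using C(1) by fastforce
    have "indep (C - {x})" using C(2) x by (auto simp: circuit_def)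
    then have "card (C - {x}) \<le> rank_of indep E"
      using indep_subset_ground by (intro card_le_rank) auto
    then have "2 * h \<le> rank_of indep E" using C(1) x by (simp add: card_Diff_singleton)
    obtain y where y: "y \<in> D" using D(1) by fastforce
    have "D \<subseteq> E" using D(2) by (simp add: cocircuit_def circuit_def)
    have "rank_of indep E = rank_of indep (E - (D - {y}))"
      using y by (intro rank_delete_part_of_cocircuit[OF D(2), symmetric]) auto
    also have "\<dots> \<le> card (E - (D - {y}))" using finite_ground by (intro rank_le_card) auto
    also have "\<dots> = card E - card (D - {y})"
      using \<open>D \<subseteq> E\<close> finite_ground finite_subset by (intro card_Diff_subset) auto
    also have "card (D - {y}) = 2 * h" using D(1) y by (simp add: card_Diff_singleton)
    finally have "rank_of indep E \<le> card E - 2 * h" .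
    then show ?thesis using \<open>2 * h \<le> rank_of indep E\<close> n(1) \<sigma>(3) by linarith
  qed
  have even_n: "even n"
  proof (rule ccontr)
    assume odd: "odd n"
    \<comment> \<open>As \<open>n\<close> is an odd subscript, the cocircuit after it occupies positions \<open>1, \<dots>, t\<close>.  The circuit
      that begins at the odd position \<open>t\<close> ends at \<open>2 * t - 1 \<le> n\<close>, so the two meet only in
      position \<open>t\<close>.\<close>
    let ?t = "2 * h + 1"
    have big: "?t + 2 * h \<le> n" using n_ge odd by presburger
    let ?C = "e ` {?t..<?t + ?t}" and ?D = "e ` {n + 1..<n + 1 + ?t}"
    have C: "circuit E indep ?C" using ord(2)[of ?t] big by simp
    have D: "cocircuit E indep ?D" using ord(4)[of n] odd big by simp
    have D_eq: "?D = e ` {1..<1 + ?t}"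
      unfolding e_def n_def
      by (rule cyc_window_cong[OF n(2)]) (use mod_add_self1[of "length \<sigma>" 1] in simp)
    have "inj_on e {1..<1 + n}"
    proof (rule eq_card_imp_inj_on)
      have "e ` {1..<1 + n} = e ` {0..<n}"
      proof -
        have "e n = e 0" using cyc_period[OF n(2), of 0] by (simp add: e_def n_def)
        moreover have "{1..<1 + n} = insert n {1..<n}" "{0..<n} = insert 0 {1..<n}"
          using big by auto
        ultimately show ?thesis by (simp only: image_insert)
      qed
      then show "card (e ` {1..<1 + n}) = card {1..<1 + n}"
        using bij n by (simp add: bij_betw_def)
    qed simp
    then have "e ` {?t + 1..<?t + ?t} \<inter> e ` {1..<1 + ?t} = e ` ({?t + 1..<?t + ?t} \<inter> {1..<1 + ?t})"
      by (rule inj_on_image_Int [symmetric]) (use big in auto)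
    also have "\<dots> = {}" by auto
    finally have disj: "e ` {?t + 1..<?t + ?t} \<inter> ?D = {}" by (simp only: D_eq)
    have C_split: "?C = insert (e ?t) (e ` {?t + 1..<?t + ?t})"
    proof -
      have "{?t..<?t + ?t} = insert ?t {?t + 1..<?t + ?t}" by auto
      then show ?thesis by (metis image_insert)
    qed
    have "rank_of indep (insert (e ?t) (e ` {?t + 1..<?t + ?t})) = rank_of indep (e ` {?t + 1..<?t + ?t})"
      by (rule circuit_spans[OF C]) (auto simp only: C_split)
    moreover have "e ` {?t + 1..<?t + ?t} \<subseteq> E - ?D"
      using C disj by (auto simp: circuit_def)
    then have "rank_of indep (insert (e ?t) (e ` {?t + 1..<?t + ?t}))
        = rank_of indep (e ` {?t + 1..<?t + ?t}) + 1"
      unfolding D_eq by (rule cocircuit_avoided[OF D[unfolded D_eq], rotated]) auto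
    ultimately show False by simp
  qed
  show ?thesis
  proof (unfold_locales, fold e_def n_def)
    show "e (i + n) = e i" for i using cyc_period[OF n(2)] by (simp add: e_def n_def)
    show "inj_on e {0..<n}" "e ` {0..<n} = E" using bij by (simp_all add: bij_betw_def)
    show "circuit E indep (e ` {i..<i + (2 * h + 1)})" if "odd i" for i
    proof -
      define j where "j = i mod n"
      have "odd j" using that even_n by (simp add: j_def dvd_mod_iff)
      moreover have "j < n" using n_ge assms(1) by (simp add: j_def)
      ultimately have "circuit E indep (e ` {j..<j + (2 * h + 1)})"
        by (intro ord(2)) (auto elim: oddE)
      moreover have "e ` {i..<i + (2 * h + 1)} = e ` {j..<j + (2 * h + 1)}"
        unfolding e_def by (rule cyc_window_cong) (use n in \<open>auto simp: j_def n_def\<close>)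
      ultimately show ?thesis by simp
    qed
    show "cocircuit E indep (e ` {i..<i + (2 * h + 1)})" if "even i" for i
    proof -
      \<comment> \<open>The odd position before \<open>i\<close>, reduced modulo \<open>n\<close>.\<close>
      define j where "j = (i + n - 1) mod n"
      have pos: "0 < n" using n_ge assms(1) by linarith
      then have "odd (i + n - 1)" using that even_n by simp
      then have "odd j" using even_n by (simp add: j_def dvd_mod_iff)
      moreover have "j < n" using pos by (simp add: j_def)
      ultimately have "cocircuit E indep (e ` {j + 1..<j + 1 + (2 * h + 1)})"
        by (intro ord(4)) (auto elim: oddE)
      moreover have "(j + 1) mod n = i mod n"
        unfolding j_def mod_add_left_eq using pos by simp
      then have "e ` {i..<i + (2 * h + 1)} = e ` {j + 1..<j + 1 + (2 * h + 1)}"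
        unfolding e_def n_def by (intro cyc_window_cong[OF n(2)]) simp
      ultimately show ?thesis by simp
    qed
  qed (use assms(1) even_n n_ge in auto)
qed

text \<open>The boundaries \<open>k m < k 1 + n < \<dots> < k (m - 1) + n\<close> of the petals with subscripts \<open>1, \<dots>, m\<close> lie in a
  single period, beginning with the first petal; they are continued with period \<open>n\<close>.\<close>

lemma concatenation_boundaries:
  assumes "concatenation es Ps" "es \<noteq> []"
  shows "\<exists>b. \<forall>j. b (j + length Ps) = b j + length es \<and>
    cyc Ps (Suc j) = cyc es ` {b j..<b (Suc j)}"
proof -
  define n where "n = length es"
  define m where "m = length Ps"
  obtain k where m: "1 \<le> m" and k0: "k 0 = k m"
    and petal: "\<And>i. 1 \<le> i \<Longrightarrow> i \<le> m \<Longrightarrow>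
      cyc Ps i = cyc es ` {k (i - 1)..<(if i = 1 then k 1 + n else k i)}"
    using assms(1) unfolding concatenation_def Let_def n_def m_def by auto
  define c where "c r = (if r = 0 then k m else k r + n)" for r
  define b where "b j = c (j mod m) + n * (j div m)" for j
  have shift: "cyc es ` {x + n * q..<y + n * q} = cyc es ` {x..<y}" for x y q
  proof (cases "x \<le> y")
    case True
    have "cyc es ` {x + n * q..<x + n * q + (y - x)} = cyc es ` {x..<x + (y - x)}"
      by (rule cyc_window_cong[OF assms(2)]) (simp add: n_def)
    moreover have "x + n * q + (y - x) = y + n * q" "x + (y - x) = y" using True by auto
    ultimately show ?thesis by simp
  qed simp
  have base: "cyc Ps (Suc r) = cyc es ` {c r..<(if Suc r < m then c (Suc r) else c 0 + n)}"
    if r: "r < m" for r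
  proof (cases "r = 0")
    case True
    then show ?thesis using petal[of 1] m k0 by (cases "m = 1") (auto simp: c_def)
  next
    case False
    have "cyc es ` {k r + n..<k (Suc r) + n} = cyc es ` {k r..<k (Suc r)}"
      using shift[of "k r" 1 "k (Suc r)"] by simp
    moreover have "c 0 + n = k (Suc r) + n" if "\<not> Suc r < m"
    proof -
      have "Suc r = m" using r that by simp
      then show ?thesis by (simp add: c_def)
    qed
    ultimately show ?thesis using petal[of "Suc r"] r False by (simp add: c_def)
  qed
  show ?thesis
  proof (intro exI[of _ b] allI conjI)
    fix j
    show "b (j + length Ps) = b j + length es"
      using m by (simp add: b_def flip: m_def n_def)
    define r where "r = j mod m"
    define q where "q = j div m"
    have r: "r < m" using m by (simp add: r_def)
    have b_Suc: "b (Suc j) = (if Suc r < m then c (Suc r) else c 0 + n) + n * q"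
      using r by (auto simp: b_def r_def q_def mod_Suc div_Suc)
    have "Ps \<noteq> []" using m by (auto simp: m_def)
    then have "cyc Ps (Suc j) = cyc Ps (Suc r)" by (simp add: cyc_Suc r_def m_def)
    also have "\<dots> = cyc es ` {c r..<(if Suc r < m then c (Suc r) else c 0 + n)}" using r by (rule base)
    also have "\<dots> = cyc es ` {b j..<b (Suc j)}"
      unfolding b_Suc using shift by (simp add: b_def r_def q_def)
    finally show "cyc Ps (Suc j) = cyc es ` {b j..<b (Suc j)}" .
  qed
qed


section \<open>The daisy\<close>

context petal_ordering
begin

lemma daisy_of_petals:
  assumes len: "length Ps = m" "1 \<le> m"
    and Ps: "\<And>j. cyc Ps (Suc j) = e ` positions {j}"
  shows "daisy E indep (2 * h + 1) Ps"
proof -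
  have union: "(\<Union>i\<in>(\<lambda>j. Suc (j mod m)) ` J. cyc Ps i) = e ` positions J" for J
  proof -
    have "Ps \<noteq> []" using len by auto
    then have "cyc Ps (Suc (j mod m)) = cyc Ps (Suc j)" for j by (simp add: cyc_Suc len)
    then have "(\<Union>i\<in>(\<lambda>j. Suc (j mod m)) ` J. cyc Ps i) = (\<Union>j\<in>J. e ` positions {j})"
      by (simp add: Ps)
    then show ?thesis by (auto simp: positions_def)
  qed
  have sep_iff: "exactly_separating E indep (2 * h + 1) (e ` A) \<longleftrightarrow>
      connectivity E indep (e ` A) = 2 * int h" for A
    using e_in_E by (auto simp: exactly_separating_def)
  have sep: "exactly_separating E indep (2 * h + 1) (e ` positions {p..<q})"
    if "p < q" "q < p + m" for p q
    unfolding sep_iff using that by (rule connectivity_consecutive_petals)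
  have window: "e ` positions {0..<m} = E"
    using all_positions[of 0] range_window by simp
  have "flower E indep (2 * h + 1) Ps"
  proof (cases "m = 1")
    case True
    then obtain P where P: "Ps = [P]" using len by (auto simp: length_Suc_conv)
    then have "P = e ` positions {0}" using Ps[of 0] by (simp add: cyc_def)
    also have "{0} = {0..<m}" using True by auto
    finally show ?thesis unfolding flower_def using P window by simp
  next
    case False
    have index: "\<exists>j. j < m \<and> i = Suc j" if "i \<in> {1..m}" for i
      using that by (intro exI[of _ "i - 1"]) auto
    have one: "{j} = {j..<Suc j}" for j :: nat by auto
    have "cyc Ps i \<noteq> {}" if i: "i \<in> {1..m}" for i
    proof -
      obtain j where j: "i = Suc j" using index[OF i] by blast
      have "b j < b (Suc j)" using b_gap[of j] h_pos by simp
      then show ?thesis by (simp add: j Ps positions_def)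
    qed
    moreover have "cyc Ps i \<inter> cyc Ps j = {}"
      if ij: "i \<in> {1..m}" "j \<in> {1..m}" "i \<noteq> j" for i j
    proof -
      obtain p where p: "p < m" "i = Suc p" using index[OF ij(1)] by blast
      obtain q where q: "q < m" "j = Suc q" using index[OF ij(2)] by blast
      note pq = p q \<open>i \<noteq> j\<close>
      have "e ` positions {q} \<subseteq> e ` positions ({0..<0 + m} - {p})"
        using pq by (intro image_mono) (auto simp: positions_def)
      also have "\<dots> = E - e ` positions {p}"
        using pq by (intro complement_petals [symmetric]) auto
      finally show ?thesis unfolding p q Ps by blast
    qed
    moreover have "(\<Union>i\<in>{1..m}. cyc Ps i) = E"
      using union[of "{0..<0 + m}"] window_image_residues[OF len(2) order_refl, of 0] window by simp
    moreover have "exactly_separating E indep (2 * h + 1) (cyc Ps i)" if i: "i \<in> {1..m}" for i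
    proof -
      obtain j where j: "i = Suc j" using index[OF i] by blast
      show ?thesis unfolding j Ps one using False len(2) by (intro sep) auto
    qed
    moreover have "exactly_separating E indep (2 * h + 1) (cyc Ps i \<union> cyc Ps (i + 1))"
      if i: "i \<in> {1..m}" "3 \<le> m" for i
    proof -
      obtain j where j: "i = Suc j" using index[OF i(1)] by blast
      have "cyc Ps i \<union> cyc Ps (i + 1) = e ` positions ({j} \<union> {Suc j})"
        by (simp add: j Ps positions_Un image_Un del: Un_insert_left Un_insert_right)
      also have "{j} \<union> {Suc j} = {j..<Suc (Suc j)}" by auto
      finally show ?thesis using sep[of j "Suc (Suc j)"] i(2) by simp
    qed
    ultimately show ?thesis
      unfolding flower_def len using False len(2) by auto
  qed
  moreover have "exactly_separating E indep (2 * h + 1) (\<Union>i\<in>I. cyc Ps i) \<longleftrightarrow> consecutive_set m I"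
    if "I \<noteq> {}" "I \<subset> {1..m}" for I
    using that
  proof (cases rule: consecutive_set_cases)
    case (consecutive p q)
    then show ?thesis using sep union by simp
  next
    case (gap p q r J)
    then have "connectivity E indep (e ` positions J) \<noteq> 2 * int h"
      using connectivity_gap_petals[of J p r q] by simp
    then show ?thesis using gap union sep_iff by simp
  qed
  ultimately show ?thesis unfolding daisy_def len by blast
qed

end

theorem theorem1p2:
  fixes E :: "'a set" and indep :: "'a set \<Rightarrow> bool"
    and t :: nat and \<sigma> :: "'a list" and \<Phi> :: "'a set list"
  assumes "odd t" and "1 < t"
    and "matroid E indep"
    and "odd_cyclic_ordering E indep t \<sigma>"
    and "concatenation \<sigma> \<Phi>"
    and "\<forall>i\<in>{1..length \<Phi>}. t - 1 \<le> card (cyc \<Phi> i)"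
  shows "daisy E indep t \<Phi> \<and>
    (3 \<le> length \<Phi> \<longrightarrow>
      (\<forall>i\<in>{1..length \<Phi>}.
        real_of_int (local_connectivity indep (cyc \<Phi> i) (cyc \<Phi> (i + 1))) = 1 / 2 * (real t - 1))) \<and>
    (\<forall>i\<in>{1..length \<Phi>}. \<forall>j\<in>{1..length \<Phi>}. non_consecutive (length \<Phi>) i j \<longrightarrow>
      real_of_int (local_connectivity indep (cyc \<Phi> i) (cyc \<Phi> j)) \<le> 1 / 2 * (real t - 3))"
proof -
  obtain h where t: "t = 2 * h + 1" using \<open>odd t\<close> by (rule oddE)
  have h: "1 \<le> h" using \<open>1 < t\<close> t by simp
  define m where "m = length \<Phi>"
  have m: "1 \<le> m" using assms(5) by (simp add: concatenation_def Let_def m_def)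
  interpret matroid E indep by fact
  interpret cyclic_matroid E indep "cyc \<sigma>" "length \<sigma>" h
    using h assms(4) unfolding t by (rule cyclic_matroid_of_ordering)
  have \<sigma>_ne: "\<sigma> \<noteq> []" using n_pos by simp
  obtain b where b: "\<And>j. b (j + m) = b j + length \<sigma>"
    and petal: "\<And>j. cyc \<Phi> (Suc j) = cyc \<sigma> ` {b j..<b (Suc j)}"
    using concatenation_boundaries[OF assms(5) \<sigma>_ne] unfolding m_def by blast
  interpret petal_ordering E indep "cyc \<sigma>" "length \<sigma>" h b m
  proof
    fix j
    have "\<Phi> \<noteq> []" using m by (auto simp: m_def)
    then have "cyc \<Phi> (Suc j) = cyc \<Phi> (Suc (j mod m))" by (simp add: cyc_Suc m_def)
    moreover have "Suc (j mod m) \<in> {1..length \<Phi>}" using m by (auto simp: m_def Suc_le_eq)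
    ultimately have "2 * h \<le> card (cyc \<Phi> (Suc j))" using assms(6) t by simp
    also have "\<dots> \<le> b (Suc j) - b j"
      unfolding petal using card_image_le[of "{b j..<b (Suc j)}" "cyc \<sigma>"] by simp
    finally show "b j + 2 * h \<le> b (Suc j)" using h by simp
  qed (rule b)
  have P: "cyc \<Phi> (Suc j) = cyc \<sigma> ` positions {j}" for j
    by (simp add: petal positions_def)
  have distant: "local_connectivity indep (cyc \<Phi> i) (cyc \<Phi> j) \<le> int h - 1"
    if ij: "i \<in> {1..m}" "j \<in> {1..m}" "non_consecutive m i j" "i < j" for i j
  proof -
    obtain p q where pq: "i = Suc p" "j = Suc q" using ij by (cases i; cases j) auto
    have "j \<noteq> i + 1" using ij(3) by (auto simp: non_consecutive_def)
    moreover have "\<not> (i = 1 \<and> j = m)"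
      using ij(3) mod_add_self1[of m 1] by (auto simp: non_consecutive_def)
    ultimately have "Suc p < q" "Suc q < p + m" using ij pq by auto
    then show ?thesis unfolding pq P by (rule local_connectivity_distant_petals)
  qed
  have local_comm: "local_connectivity indep X Y = local_connectivity indep Y X" for X Y
    by (simp add: local_connectivity_def Un_commute)
  have "daisy E indep t \<Phi>"
    unfolding t by (rule daisy_of_petals) (use m P in \<open>simp_all add: m_def\<close>)
  moreover have "real_of_int (local_connectivity indep (cyc \<Phi> i) (cyc \<Phi> (i + 1))) = 1 / 2 * (real t - 1)"
    if i: "3 \<le> m" "i \<in> {1..m}" for i
  proof -
    obtain p where "i = Suc p" using i(2) by (cases i) auto
    then show ?thesis using local_connectivity_adjacent_petals[OF i(1), of p] t by (simp add: P)
  qed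
  moreover have "real_of_int (local_connectivity indep (cyc \<Phi> i) (cyc \<Phi> j)) \<le> 1 / 2 * (real t - 3)"
    if ij: "i \<in> {1..m}" "j \<in> {1..m}" "non_consecutive m i j" for i j
  proof -
    have "i \<noteq> j" "non_consecutive m j i" using ij(3) by (auto simp: non_consecutive_def)
    then have "local_connectivity indep (cyc \<Phi> i) (cyc \<Phi> j) \<le> int h - 1"
      using distant[OF ij] distant[OF ij(2,1)] local_comm[of "cyc \<Phi> i"] by (cases "i < j") auto
    then show ?thesis using t by simp
  qed
  ultimately show ?thesis unfolding m_def by blast
qed

end
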